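(* Let $p$ be greater than $1$ and let $U$ be the uniform distribution over $G_{n,p}$, that is, $U = \sum_{w\in G_{n,p}}\frac{1}{p^nn!}w$. Then, \[ d_{TV}\left(\left(\frac{1}{pn}{\mathbf B}_1\right)^k, \,U\right) \leq 1-\frac{{k\brace n}n!}{n^k}. \]
   Context: $G_{n,p}=C_p\wr\mathfrak S_n$ is the colored permutation group (pairs $(s,\sigma)$, $s\in C_p^n$, $\sigma\in\mathfrak S_n$, product $(t,\tau)(s,\sigma)=(\sigma t+s,\tau\sigma)$, $\sigma t=(t_{\sigma(1)},\ldots,t_{\sigma(n)})$), whose elements are regarded as words $(s_1,\sigma(1))\cdots(s_n,\sigma(n))$ over $C_p\times[n]$. For words $u,v$, $u\sqcup\!\sqcup v$ is the shuffle product (formal sum of all interleavings). With $W_{1,n}=(0,2)\cdots(0,n)$, ${\mathbf B}_1=\sum_{j=0}^{p-1}(j,1)\sqcup\!\sqcup W_{1,n}$, so $\frac{1}{pn}{\mathbf B}_1$ is the top-to-random shuffle distribution on $G_{n,p}$ and powers are taken in ${\mathbb R}G_{n,p}$. $d_{TV}({\bf P},{\bf Q})=\frac12|{\bf P}-{\bf Q}|$, where $|\sum c_w w|=\sum|c_w|$. ${k\brace n}$ is the Stirling number of the second kind. *)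

theory Defs
  imports
    Complex_Main
    "HOL-Library.Multiset"
    "HOL-Combinatorics.Stirling"
    "HOL-Algebra.Algebra"
    "HOL-Algebra.Product_Groups"
    "HOL-Algebra.Module"
begin

section \<open>The colored permutation group and its elements as words\<close>

definition colored_perm_group :: "nat \<Rightarrow> nat \<Rightarrow> ((nat \<Rightarrow> int) \<times> (nat \<Rightarrow> nat)) monoid" where
  "colored_perm_group n p =
    (let C = product_group {1..n} (\<lambda>_. integer_mod_group p); S = sym_group n in
     \<lparr>carrier = carrier C \<times> carrier S,
      monoid.mult = (\<lambda>(t, \<tau>) (s, \<sigma>). ((\<lambda>i\<in>{1..n}. t (\<sigma> i)) \<otimes>\<^bsub>C\<^esub> s, \<tau> \<otimes>\<^bsub>S\<^esub> \<sigma>)),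
      one = (\<one>\<^bsub>C\<^esub>, \<one>\<^bsub>S\<^esub>)\<rparr>)"

lemma group_colored_perm_group: "group (colored_perm_group n p)"
proof -
  let ?C = "product_group {1..n} (\<lambda>_. integer_mod_group p)"
  let ?S = "sym_group n"
  interpret Z: group "integer_mod_group p" by simp
  interpret C: group ?C by simp
  interpret S: group ?S by (rule sym_group_is_group)
  have perm: "\<sigma> i \<in> {1..n}" if "\<sigma> \<in> carrier ?S" "i \<in> {1..n}" for \<sigma> i
    using that permutes_in_image by (metis sym_group_carrier)
  have act: "(\<lambda>i\<in>{1..n}. t (\<sigma> i)) \<in> carrier ?C" if "t \<in> carrier ?C" "\<sigma> \<in> carrier ?S" for t \<sigma>
    using that perm by (force simp: PiE_def Pi_def)
  show ?thesis
  proof (rule groupI, goal_cases)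
    case (1 x y)
    then show ?case
      using act C.m_closed S.m_closed by (auto simp: colored_perm_group_def Let_def simp del: One_nat_def carrier_product_group mult_product_group)
  next
    case 2
    show ?case
      by (auto simp: colored_perm_group_def Let_def simp del: One_nat_def carrier_product_group one_product_group)
  next
    case (3 x y z)
    obtain u \<rho> t \<tau> s \<sigma> where e: "x = (u, \<rho>)" "y = (t, \<tau>)" "z = (s, \<sigma>)"
      by (metis surj_pair)
    with 3 perm show ?case
      by (auto simp: colored_perm_group_def Let_def sym_group_mult o_assoc mod_simps ac_simps
          intro!: restrict_ext)
  next
    case (4 x)
    obtain s \<sigma> where e: "x = (s, \<sigma>)" by (metis surj_pair)
    with 4 perm show ?case
      by (auto simp: colored_perm_group_def Let_def sym_group_mult sym_group_one carrier_integer_mod_group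
          PiE_def extensional_def fun_eq_iff Pi_def split: if_splits)
  next
    case (5 x)
    obtain s \<sigma> where e: "x = (s, \<sigma>)" by (metis surj_pair)
    have s: "s \<in> carrier ?C" and \<sigma>: "\<sigma> \<in> carrier ?S"
      using 5 e by (auto simp: colored_perm_group_def Let_def)
    define t where "t = (\<lambda>i\<in>{1..n}. inv\<^bsub>integer_mod_group p\<^esub> s ((inv\<^bsub>?S\<^esub> \<sigma>) i))"
    have inv: "(inv\<^bsub>?S\<^esub> \<sigma>) (\<sigma> i) = i" for i
      using S.l_inv[OF \<sigma>] by (auto simp: sym_group_mult sym_group_one fun_eq_iff)
    have si: "s i \<in> carrier (integer_mod_group p)" if "i \<in> {1..n}" for i
      using s that by auto
    have "t \<in> carrier ?C"
      using s perm[OF S.inv_closed[OF \<sigma>]] by (auto simp: t_def simp del: inv_integer_mod_group)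
    moreover have "(\<lambda>i\<in>{1..n}. t (\<sigma> i)) \<otimes>\<^bsub>?C\<^esub> s = \<one>\<^bsub>?C\<^esub>"
      using perm[OF \<sigma>] Z.l_inv[OF si]
      by (auto simp: t_def inv simp del: inv_integer_mod_group mult_integer_mod_group
          one_integer_mod_group intro!: restrict_ext)
    ultimately show ?case
      using S.inv_closed[OF \<sigma>] S.l_inv[OF \<sigma>]
      by (intro bexI[of _ "(t, inv\<^bsub>?S\<^esub> \<sigma>)"])
        (auto simp: e colored_perm_group_def Let_def simp del: mult_product_group one_product_group)
  qed
qed

text \<open>Letters are pairs of a color and a value.\<close>

definition word_of :: "nat \<Rightarrow> (nat \<Rightarrow> int) \<times> (nat \<Rightarrow> nat) \<Rightarrow> (int \<times> nat) list" where
  "word_of n = (\<lambda>(s, \<sigma>). map (\<lambda>i. (s i, \<sigma> i)) [1..<Suc n])"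

text \<open>
  The shuffle product as a formal sum of words, represented by the multiset of its terms.
  The function \<^const>\<open>shuffles\<close> only gives the underlying set, without multiplicities.
\<close>

fun shuffle_prod :: "'a list \<Rightarrow> 'a list \<Rightarrow> 'a list multiset" where
  "shuffle_prod [] v = {#v#}"
| "shuffle_prod u [] = {#u#}"
| "shuffle_prod (a # u) (b # v) =
     image_mset ((#) a) (shuffle_prod u (b # v)) + image_mset ((#) b) (shuffle_prod (a # u) v)"

lemma set_mset_shuffle_prod: "set_mset (shuffle_prod u v) = shuffles u v"
  by (induction u v rule: shuffle_prod.induct) auto

lemma size_shuffle_prod: "size (shuffle_prod u v) = (length u + length v) choose length u"
  by (induction u v rule: shuffle_prod.induct) auto

section \<open>The real group algebra\<close>

text \<open>
  Elements are finitely supported coefficient functions vanishing outside the carrier of the group.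
\<close>

definition group_algebra :: "('g, 'm) monoid_scheme \<Rightarrow> (real, 'g \<Rightarrow> real) module" where
  "group_algebra G =
    \<lparr>carrier = {f. finite {x. f x \<noteq> 0} \<and> {x. f x \<noteq> 0} \<subseteq> carrier G},
     monoid.mult = (\<lambda>f g x. \<Sum>(a, b) | f a \<noteq> 0 \<and> g b \<noteq> 0 \<and> a \<otimes>\<^bsub>G\<^esub> b = x. f a * g b),
     one = (\<lambda>x. if x = \<one>\<^bsub>G\<^esub> then 1 else 0),
     ring.zero = (\<lambda>x. 0),
     ring.add = (\<lambda>f g x. f x + g x),
     module.smult = (\<lambda>c f x. c * f x)\<rparr>"

definition coeff_norm :: "('g \<Rightarrow> real) \<Rightarrow> real" where
  "coeff_norm f = (\<Sum>x | f x \<noteq> 0. \<bar>f x\<bar>)"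

definition d_TV :: "('g \<Rightarrow> real) \<Rightarrow> ('g \<Rightarrow> real) \<Rightarrow> real" where
  "d_TV P Q = 1/2 * coeff_norm (\<lambda>x. P x - Q x)"

definition uniform_distr :: "nat \<Rightarrow> nat \<Rightarrow> (nat \<Rightarrow> int) \<times> (nat \<Rightarrow> nat) \<Rightarrow> real" where
  "uniform_distr n p =
    (\<lambda>w. if w \<in> carrier (colored_perm_group n p) then 1 / (real p ^ n * fact n) else 0)"

section \<open>The top-to-random shuffle element\<close>

definition W\<^sub>1 :: "nat \<Rightarrow> (int \<times> nat) list" where
  "W\<^sub>1 n = map (\<lambda>i. (0, i)) [2..<Suc n]"

definition B\<^sub>1_words :: "nat \<Rightarrow> nat \<Rightarrow> (int \<times> nat) list multiset" where
  "B\<^sub>1_words n p = (\<Sum>j = 0..<int p. shuffle_prod [(j, 1)] (W\<^sub>1 n))"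

definition B\<^sub>1 :: "nat \<Rightarrow> nat \<Rightarrow> (nat \<Rightarrow> int) \<times> (nat \<Rightarrow> nat) \<Rightarrow> real" where
  "B\<^sub>1 n p =
    (\<lambda>w. if w \<in> carrier (colored_perm_group n p) then real (count (B\<^sub>1_words n p) (word_of n w)) else 0)"


text \<open>
  Every term of the formal sum of words is the word of exactly one group element, so passing from
  words to group elements loses nothing.
\<close>

lemma inj_on_word_of: "inj_on (word_of n) (carrier (colored_perm_group n p))"
proof (rule inj_onI)
  fix x y
  assume x: "x \<in> carrier (colored_perm_group n p)" and y: "y \<in> carrier (colored_perm_group n p)"
    and eq: "word_of n x = word_of n y"
  obtain s \<sigma> t \<tau> where e: "x = (s, \<sigma>)" "y = (t, \<tau>)" by (metis surj_pair)
  have "s i = t i \<and> \<sigma> i = \<tau> i" if "i \<in> {1..n}" for i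
    using eq that by (auto simp: word_of_def e simp del: upt_Suc)
  moreover have "s i = t i \<and> \<sigma> i = \<tau> i" if "i \<notin> {1..n}" for i
    using x y that
    by (auto simp: e colored_perm_group_def Let_def PiE_def extensional_def sym_group_carrier permutes_def)
  ultimately show "x = y"
    unfolding e by (metis ext)
qed

lemma B\<^sub>1_words_subset:
  assumes "n \<ge> 1"
  shows "set_mset (B\<^sub>1_words n p) \<subseteq> word_of n ` carrier (colored_perm_group n p)"
proof
  fix w assume "w \<in># B\<^sub>1_words n p"
  then obtain j where j: "j \<in> {0..<int p}" and w: "w \<in> shuffles [(j, 1)] (W\<^sub>1 n)"
    by (auto simp: B\<^sub>1_words_def set_mset_sum set_mset_shuffle_prod)
  have len: "length w = n" and set: "set w = insert (j, 1) (set (W\<^sub>1 n))"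
    using length_shuffles[OF w] set_shuffles[OF w] assms by (auto simp: W\<^sub>1_def)
  define s where "s = (\<lambda>i\<in>{1..n}. fst (w ! (i - 1)))"
  define \<sigma> where "\<sigma> = (\<lambda>i. if i \<in> {1..n} then snd (w ! (i - 1)) else i)"
  have "word_of n (s, \<sigma>) = w"
    by (rule nth_equalityI) (auto simp: word_of_def len s_def \<sigma>_def simp del: upt_Suc)
  moreover have "s \<in> {1..n} \<rightarrow>\<^sub>E {0..<int p}"
  proof -
    have "fst x \<in> {0..<int p}" if "x \<in> set w" for x
      using that j unfolding set by (auto simp: W\<^sub>1_def)
    from this[OF nth_mem] show ?thesis
      by (auto simp: s_def len)
  qed
  moreover have "\<sigma> permutes {1..n}"
  proof -
    have "\<sigma> ` {1..n} = snd ` set w"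
      by (force simp: \<sigma>_def set_conv_nth len image_iff Bex_def intro: exI[of _ "Suc _"])
    also have "\<dots> = {1..n}"
      using assms unfolding set by (auto simp: W\<^sub>1_def image_image)
    finally have "bij_betw \<sigma> {1..n} {1..n}"
      by (auto simp: bij_betw_def intro: eq_card_imp_inj_on)
    then show ?thesis
      by (rule bij_imp_permutes) (auto simp: \<sigma>_def)
  qed
  ultimately show "w \<in> word_of n ` carrier (colored_perm_group n p)"
    using j by (intro image_eqI[of _ _ "(s, \<sigma>)"])
      (auto simp: colored_perm_group_def Let_def carrier_integer_mod_group sym_group_carrier)
qed

end

theory Submission
  imports Defs
begin

text \<open>
  Let \<open>A\<^sub>a\<close> be the set of words in which the letters above \<open>a\<close> are uncolored and appear in increasing
  order. A word \<open>w\<close> arises by a top-to-random step from a word in \<open>A\<^sub>a\<close> in \<open>pa\<close> ways if \<open>w \<in> A\<^sub>a\<close> (move any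
  letter \<open>\<le> a\<close> to the front and recolor it), and in one further way, through the letter \<open>a + 1\<close>, if
  \<open>w \<in> A\<^sub>a\<^sub>+\<^sub>1\<close>. This is the recursion of the Stirling numbers, so the \<open>k\<close>-th power of \<open>B\<^sub>1\<close> is at least
  \<open>\<Sum>\<^sub>a p\<^sup>k\<^sup>-\<^sup>a S(k,a)\<close> times the indicator of \<open>A\<^sub>a\<close>. As \<open>A\<^sub>n\<close> is the whole group, the normalised power dominates
  \<open>c U\<close> with \<open>c = S(k,n) n! / n\<^sup>k\<close>, and a distribution that dominates \<open>c U\<close> has distance at most
  \<open>1 - c\<close> from \<open>U\<close>.
\<close>

section \<open>Convolution on a finite group\<close>

lemma group_algebra_simps:
  "\<one>\<^bsub>group_algebra G\<^esub> = (\<lambda>x. if x = \<one>\<^bsub>G\<^esub> then 1 else 0)"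
  "c \<odot>\<^bsub>group_algebra G\<^esub> f = (\<lambda>x. c * f x)"
  "(f \<otimes>\<^bsub>group_algebra G\<^esub> g) x =
    (\<Sum>(a, b) | f a \<noteq> 0 \<and> g b \<noteq> 0 \<and> a \<otimes>\<^bsub>G\<^esub> b = x. f a * g b)"
  by (simp_all add: group_algebra_def)

context group
begin

text \<open>In a group, a factorization of \<open>x\<close> is determined by its right factor
  \<open>b\<close>, the left one being \<open>x\<close> times \<open>inv b\<close>; pairs outside
  the supports contribute zero.\<close>

lemma group_algebra_mult:
  assumes fin: "finite (carrier G)"
    and f: "\<And>x. x \<notin> carrier G \<Longrightarrow> f x = 0" and g: "\<And>x. x \<notin> carrier G \<Longrightarrow> g x = 0"
  shows "(f \<otimes>\<^bsub>group_algebra G\<^esub> g) x =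
    (if x \<in> carrier G then \<Sum>b\<in>carrier G. f (x \<otimes> inv b) * g b else 0)"
proof (cases "x \<in> carrier G")
  case False
  have empty: "{(a, b). f a \<noteq> 0 \<and> g b \<noteq> 0 \<and> a \<otimes> b = x} = {}"
    using f g False m_closed by blast
  show ?thesis
    unfolding group_algebra_simps empty using False by simp
next
  case True
  define D where "D = {b \<in> carrier G. f (x \<otimes> inv b) \<noteq> 0 \<and> g b \<noteq> 0}"
  have inj: "inj_on (\<lambda>b. (x \<otimes> inv b, b)) D"
    by (auto intro: inj_onI)
  have "(\<lambda>b. (x \<otimes> inv b, b)) ` D = {(a, b). f a \<noteq> 0 \<and> g b \<noteq> 0 \<and> a \<otimes> b = x}"
  proof (intro equalityI subsetI; clarsimp simp: D_def image_iff)
    fix b assume "b \<in> carrier G"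
    then show "x \<otimes> inv b \<otimes> b = x"
      using True by (simp add: m_assoc)
  next
    fix a b assume "f a \<noteq> 0" "g b \<noteq> 0" "x = a \<otimes> b"
    moreover from this have "a \<in> carrier G" "b \<in> carrier G"
      using f g by auto
    moreover from this have "a \<otimes> b \<otimes> inv b = a"
      by (simp add: m_assoc)
    ultimately show "b \<in> carrier G \<and> f (a \<otimes> b \<otimes> inv b) \<noteq> 0 \<and> a = a \<otimes> b \<otimes> inv b"
      by simp
  qed
  then have "(f \<otimes>\<^bsub>group_algebra G\<^esub> g) x = (\<Sum>b\<in>D. f (x \<otimes> inv b) * g b)"
    unfolding group_algebra_simps using sum.reindex[OF inj, of "\<lambda>(a, b). f a * g b"] by simp
  also have "\<dots> = (\<Sum>b\<in>carrier G. f (x \<otimes> inv b) * g b)"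
    by (rule sum.mono_neutral_left) (auto simp: D_def fin)
  finally show ?thesis
    using True by simp
qed

text \<open>Summing over \<open>x\<close> first for fixed \<open>b\<close>, right translation by
  \<open>inv b\<close> permutes the group, so every inner sum is the total mass of
  \<open>f\<close>.\<close>

lemma group_algebra_sum_mult:
  assumes fin: "finite (carrier G)"
    and f: "\<And>x. x \<notin> carrier G \<Longrightarrow> f x = 0" and g: "\<And>x. x \<notin> carrier G \<Longrightarrow> g x = 0"
  shows "sum (f \<otimes>\<^bsub>group_algebra G\<^esub> g) (carrier G) = sum f (carrier G) * sum g (carrier G)"
proof -
  have "sum (f \<otimes>\<^bsub>group_algebra G\<^esub> g) (carrier G) =
      (\<Sum>x\<in>carrier G. \<Sum>b\<in>carrier G. f (x \<otimes> inv b) * g b)"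
    by (simp add: group_algebra_mult[OF assms])
  also have "\<dots> = (\<Sum>b\<in>carrier G. (\<Sum>x\<in>carrier G. f (x \<otimes> inv b)) * g b)"
    unfolding sum_distrib_right by (rule sum.swap)
  also have "(\<Sum>x\<in>carrier G. f (x \<otimes> inv b)) = sum f (carrier G)" if b: "b \<in> carrier G" for b
    by (rule sum.reindex_bij_witness[where i = "\<lambda>x. x \<otimes> b" and j = "\<lambda>x. x \<otimes> inv b"])
      (use b in \<open>auto simp: m_assoc\<close>)
  then have "(\<Sum>b\<in>carrier G. (\<Sum>x\<in>carrier G. f (x \<otimes> inv b)) * g b) =
      (\<Sum>b\<in>carrier G. sum f (carrier G) * g b)"
    by simp
  finally show ?thesis
    by (simp add: sum_distrib_left)
qed

text \<open>One induction carries all three claims, since the convolution formula behind sign and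
  mass requires the previous power to vanish outside the group.\<close>

lemma group_algebra_pow_distribution:
  fixes k :: nat
  assumes fin: "finite (carrier G)"
    and f: "\<And>x. x \<notin> carrier G \<Longrightarrow> f x = 0" and nonneg: "\<And>x. f x \<ge> 0"
    and total: "sum f (carrier G) = 1"
  defines "P \<equiv> f [^]\<^bsub>group_algebra G\<^esub> k"
  shows group_algebra_pow_outside: "\<And>x. x \<notin> carrier G \<Longrightarrow> P x = 0"
    and group_algebra_pow_nonneg: "\<And>x. P x \<ge> 0"
    and group_algebra_pow_total: "sum P (carrier G) = 1"
proof -
  have "(\<forall>x. x \<notin> carrier G \<longrightarrow> P x = 0) \<and> (\<forall>x. P x \<ge> 0) \<and> sum P (carrier G) = 1"
    unfolding P_def
  proof (induction k)
    case 0
    then show ?case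
      by (auto simp: group_algebra_simps fin sum.delta)
  next
    case (Suc k)
    define Q where "Q = f [^]\<^bsub>group_algebra G\<^esub> k"
    have Q: "\<And>x. x \<notin> carrier G \<Longrightarrow> Q x = 0" "\<And>x. Q x \<ge> 0" "sum Q (carrier G) = 1"
      using Suc by (auto simp: Q_def)
    have "sum (Q \<otimes>\<^bsub>group_algebra G\<^esub> f) (carrier G) = 1"
      by (subst group_algebra_sum_mult[OF fin Q(1) f]) (simp_all add: Q total)
    then show ?case
      by (auto simp: group_algebra_mult[OF fin Q(1) f] simp flip: Q_def
          intro!: sum_nonneg mult_nonneg_nonneg nonneg Q(2))
  qed
  then show "\<And>x. x \<notin> carrier G \<Longrightarrow> P x = 0" "\<And>x. P x \<ge> 0" "sum P (carrier G) = 1"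
    by auto
qed

end

section \<open>Total variation distance from a minorization\<close>

text \<open>On \<open>S\<close>, \<open>P - Q\<close> is the difference of the nonnegative functions
  \<open>P - c Q\<close> and \<open>(1 - c) Q\<close>, each of mass \<open>1 - c\<close>, so its
  norm is at most \<open>2 (1 - c)\<close>.\<close>

lemma d_TV_le_of_minorized:
  assumes fin: "finite S"
    and P: "\<And>x. x \<notin> S \<Longrightarrow> P x = 0" "sum P S = 1"
    and Q: "\<And>x. x \<notin> S \<Longrightarrow> Q x = 0" "\<And>x. Q x \<ge> 0" "sum Q S = 1"
    and minor: "\<And>x. x \<in> S \<Longrightarrow> P x \<ge> c * Q x"
  shows "d_TV P Q \<le> 1 - c"
proof -
  have "(\<Sum>x\<in>S. c * Q x) \<le> sum P S"
    by (rule sum_mono) (rule minor)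
  then have c: "c \<le> 1"
    by (simp add: P Q flip: sum_distrib_left)
  have "x \<in> S" if "P x - Q x \<noteq> 0" for x
    using that P(1)[of x] Q(1)[of x] by (cases "x \<in> S") auto
  then have "coeff_norm (\<lambda>x. P x - Q x) = (\<Sum>x\<in>S. \<bar>P x - Q x\<bar>)"
    unfolding coeff_norm_def by (intro sum.mono_neutral_left fin) auto
  also have "\<dots> \<le> (\<Sum>x\<in>S. (P x - c * Q x) + (1 - c) * Q x)"
  proof (rule sum_mono)
    fix x assume "x \<in> S"
    have "P x - Q x = (P x - c * Q x) - (1 - c) * Q x"
      by (simp add: algebra_simps)
    moreover have "(1 - c) * Q x \<ge> 0"
      using c Q(2) by simp
    ultimately show "\<bar>P x - Q x\<bar> \<le> (P x - c * Q x) + (1 - c) * Q x"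
      using minor[OF \<open>x \<in> S\<close>] by linarith
  qed
  also have "\<dots> = 2 * (1 - c)"
    by (simp add: sum.distrib sum_subtractf P Q flip: sum_distrib_left)
  finally show ?thesis
    by (simp add: d_TV_def)
qed

section \<open>The colored permutation group\<close>

lemma colored_perm_group_carrier:
  assumes "p > 0"
  shows "(s, \<sigma>) \<in> carrier (colored_perm_group n p) \<longleftrightarrow>
    s \<in> {1..n} \<rightarrow>\<^sub>E {0..<int p} \<and> \<sigma> permutes {1..n}"
  using assms by (auto simp: colored_perm_group_def Let_def carrier_integer_mod_group sym_group_carrier)

lemma colored_perm_group_mult:
  "(t, \<tau>) \<otimes>\<^bsub>colored_perm_group n p\<^esub> (s, \<sigma>) =
    (\<lambda>i\<in>{1..n}. (t (\<sigma> i) + s i) mod int p, \<tau> \<circ> \<sigma>)"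
  by (auto simp: colored_perm_group_def Let_def sym_group_mult fun_eq_iff)

lemma colored_perm_group_one: "\<one>\<^bsub>colored_perm_group n p\<^esub> = (\<lambda>i\<in>{1..n}. 0, id)"
  by (auto simp: colored_perm_group_def Let_def sym_group_one fun_eq_iff)

lemma
  assumes "p > 0"
  shows finite_colored_perm_group: "finite (carrier (colored_perm_group n p))"
    and card_colored_perm_group: "card (carrier (colored_perm_group n p)) = p ^ n * fact n"
proof -
  have "carrier (colored_perm_group n p) = ({1..n} \<rightarrow>\<^sub>E {0..<int p}) \<times> {\<sigma>. \<sigma> permutes {1..n}}"
    using colored_perm_group_carrier[OF assms] by auto
  then show "finite (carrier (colored_perm_group n p))"
    and "card (carrier (colored_perm_group n p)) = p ^ n * fact n"
    by (simp_all add: finite_PiE finite_permutations card_cartesian_product card_PiE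
        card_permutations[of _ n])
qed

section \<open>Top-to-random steps as group elements\<close>

lemma shuffles_single: "us @ a # vs \<in> shuffles [a] (us @ vs)"
proof (induction us)
  case Nil
  show ?case by (cases vs) (auto intro: Cons_in_shuffles_leftI)
next
  case (Cons b us)
  then show ?case by (auto intro: Cons_in_shuffles_rightI)
qed

text \<open>For \<open>m >= 1\<close> this is the cycle \<open>(1 2 ... m)\<close> on places, in
  one-line notation \<open>2, ..., m, 1, m+1, ...\<close>.\<close>

definition insertion_perm :: "nat \<Rightarrow> nat \<Rightarrow> nat" where
  "insertion_perm m i = (if 1 \<le> i \<and> i < m then Suc i else if i = m then 1 else i)"

text \<open>Right multiplication by \<open>insertion n j m\<close> moves the first letter of a word to place \<open>m\<close> and adds
  \<open>j\<close> to its color.\<close>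

definition insertion :: "nat \<Rightarrow> int \<Rightarrow> nat \<Rightarrow> (nat \<Rightarrow> int) \<times> (nat \<Rightarrow> nat)" where
  "insertion n j m = (\<lambda>i\<in>{1..n}. if i = m then j else 0, insertion_perm m)"

lemma insertion_perm_permutes:
  assumes "m \<in> {1..n}"
  shows "insertion_perm m permutes {1..n}"
proof (rule bij_imp_permutes)
  have "inj_on (insertion_perm m) {1..n}"
    by (auto simp: inj_on_def insertion_perm_def)
  moreover have "insertion_perm m ` {1..n} \<subseteq> {1..n}"
    using assms by (auto simp: insertion_perm_def)
  ultimately show "bij_betw (insertion_perm m) {1..n} {1..n}"
    by (simp add: bij_betw_def endo_inj_surj)
qed (use assms in \<open>auto simp: insertion_perm_def\<close>)

lemma insertion_in_carrier:
  assumes "m \<in> {1..n}" and "j \<in> {0..<int p}"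
  shows "insertion n j m \<in> carrier (colored_perm_group n p)"
  using assms insertion_perm_permutes[OF assms(1)]
  by (auto simp: insertion_def colored_perm_group_carrier)

lemma B\<^sub>1_insertion:
  assumes m: "m \<in> {1..n}" and j: "j \<in> {0..<int p}"
  shows "B\<^sub>1 n p (insertion n j m) \<ge> 1"
proof -
  \<comment> \<open>Places count from 1, so \<open>m - 1\<close> letters of
    \<open>W\<^sub>1 n\<close> precede a letter inserted at place \<open>m\<close>.\<close>
  let ?us = "take (m - 1) (W\<^sub>1 n)" and ?vs = "drop (m - 1) (W\<^sub>1 n)"
  have "word_of n (insertion n j m) = ?us @ (j, 1) # ?vs"
    using m by (intro nth_equalityI)
      (auto simp: word_of_def insertion_def insertion_perm_def W\<^sub>1_def nth_append nth_Cons'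
        simp del: upt_Suc)
  also have "\<dots> \<in> shuffles [(j, 1)] (W\<^sub>1 n)"
    using shuffles_single[of ?us "(j, 1)" ?vs] by simp
  finally have "word_of n (insertion n j m) \<in># B\<^sub>1_words n p"
    using j by (auto simp: B\<^sub>1_words_def set_mset_sum set_mset_shuffle_prod)
  then show ?thesis
    using insertion_in_carrier[OF assms] by (simp add: B\<^sub>1_def Suc_le_eq)
qed

text \<open>The value 1 occurs only at place \<open>m\<close>, with color \<open>j\<close>, so both
  parameters can be read off. Sums over pairs \<open>(j, m)\<close> thus become sums over distinct
  group elements.\<close>

lemma inj_on_insertion:
  "inj_on (\<lambda>(j, m). insertion n j m) ({0..<int p} \<times> {1..n})"
proof (rule inj_onI, clarify)
  fix j m j' m'
  assume *: "m \<in> {1..n}" "m' \<in> {1..n}" and eq: "insertion n j m = insertion n j' m'"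
  have "insertion_perm m = insertion_perm m'"
    using eq by (simp add: insertion_def)
  then have "insertion_perm m' m' = insertion_perm m m'"
    by simp
  then have "m' \<le> m"
    using * by (simp add: insertion_perm_def split: if_splits)
  moreover have "insertion_perm m m = insertion_perm m' m"
    using \<open>insertion_perm m = insertion_perm m'\<close> by simp
  then have "m \<le> m'"
    using * by (simp add: insertion_perm_def split: if_splits)
  ultimately have "m = m'"
    by simp
  moreover have "j = j'"
    using fun_cong[of _ _ m, OF arg_cong[OF eq, of fst]] * \<open>m = m'\<close> by (simp add: insertion_def)
  ultimately show "j = j' \<and> m = m'"
    by simp
qed

section \<open>Total mass of the top-to-random element\<close>

text \<open>Every term of the formal sum is the word of exactly one group element, so the mass is
  the number of terms: \<open>n\<close> interleavings for each of \<open>p\<close> colors.\<close>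

lemma sum_B\<^sub>1:
  assumes n: "n \<ge> 1" and p: "p > 0"
  shows "sum (B\<^sub>1 n p) (carrier (colored_perm_group n p)) = real p * real n"
proof -
  let ?C = "carrier (colored_perm_group n p)" and ?W = "word_of n"
  have "sum (B\<^sub>1 n p) ?C = real (\<Sum>w\<in>?W ` ?C. count (B\<^sub>1_words n p) w)"
    by (simp add: B\<^sub>1_def sum.reindex[OF inj_on_word_of])
  also have "(\<Sum>w\<in>?W ` ?C. count (B\<^sub>1_words n p) w) = size (B\<^sub>1_words n p)"
    unfolding size_multiset_overloaded_eq
    using B\<^sub>1_words_subset[OF n, of p] finite_colored_perm_group[OF p]
    by (intro sum.mono_neutral_right) (auto simp: not_in_iff)
  also have "\<dots> = p * n"
  proof -
    have "Suc (length (W\<^sub>1 n)) = n"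
      using n by (simp add: W\<^sub>1_def del: upt_Suc)
    then show ?thesis
      by (simp add: B\<^sub>1_words_def size_shuffle_prod)
  qed
  finally show ?thesis
    by simp
qed

lemma top_to_random_distribution:
  fixes n p :: nat
  assumes n: "n \<ge> 1" and p: "p > 0"
  defines "P \<equiv> (1 / (real p * real n)) \<odot>\<^bsub>group_algebra (colored_perm_group n p)\<^esub> B\<^sub>1 n p"
  shows "\<And>x. x \<notin> carrier (colored_perm_group n p) \<Longrightarrow> P x = 0"
    and "\<And>x. P x \<ge> 0"
    and "sum P (carrier (colored_perm_group n p)) = 1"
proof -
  show "P x = 0" if "x \<notin> carrier (colored_perm_group n p)" for x
    using that by (simp add: P_def group_algebra_simps B\<^sub>1_def)
  show "P x \<ge> 0" for x
    by (simp add: P_def group_algebra_simps B\<^sub>1_def)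
  show "sum P (carrier (colored_perm_group n p)) = 1"
    using n p by (simp add: P_def group_algebra_simps sum_B\<^sub>1 flip: sum_divide_distrib)
qed

section \<open>Words that are increasing above a threshold\<close>

text \<open>These are the sets \<open>A\<^sub>a\<close>; a letter counts as above \<open>a\<close>
  by its value, not by its place.\<close>

definition incr_above :: "nat \<Rightarrow> nat \<Rightarrow> nat \<Rightarrow> ((nat \<Rightarrow> int) \<times> (nat \<Rightarrow> nat)) set" where
  "incr_above n p a = {(s, \<sigma>) \<in> carrier (colored_perm_group n p).
     \<forall>i\<in>{1..n}. a < \<sigma> i \<longrightarrow> s i = 0 \<and> (\<forall>i'\<in>{1..n}. i < i' \<longrightarrow> a < \<sigma> i' \<longrightarrow> \<sigma> i < \<sigma> i')}"

text \<open>This anchors the induction on the exponent: the zeroth power is the indicator of the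
  identity.\<close>

lemma incr_above_0:
  assumes p: "p > 0" and x: "x \<in> incr_above n p 0"
  shows "x = \<one>\<^bsub>colored_perm_group n p\<^esub>"
proof -
  obtain s \<sigma> where e: "x = (s, \<sigma>)" by (cases x)
  have s: "s \<in> {1..n} \<rightarrow>\<^sub>E {0..<int p}" and \<sigma>: "\<sigma> permutes {1..n}"
    using x colored_perm_group_carrier[OF p] by (auto simp: e incr_above_def)
  have pos: "0 < \<sigma> i" if "i \<in> {1..n}" for i
    using permutes_in_image[OF \<sigma>, of i] that by auto
  have s0: "s i = 0" and mono: "i' \<in> {1..n} \<Longrightarrow> i < i' \<Longrightarrow> \<sigma> i < \<sigma> i'" if "i \<in> {1..n}" for i i'
    using x pos that by (auto simp: e incr_above_def)
  \<comment> \<open>A strictly increasing sequence of positive integers satisfies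
    \<open>i <= \<sigma> i\<close>, and a permutation of \<open>{1..n}\<close> with this property is
    the identity.\<close>
  have "i \<le> n \<Longrightarrow> i \<le> \<sigma> i" for i
  proof (induction i)
    case (Suc i)
    then show ?case
      using mono[of i "Suc i"] pos[of "Suc i"] by (cases "i = 0") auto
  qed simp
  then have "\<sigma> = id"
    by (intro permutes_natset_ge[OF \<sigma>]) auto
  moreover have "s = (\<lambda>i\<in>{1..n}. 0)"
    using s s0 by (intro ext) (auto simp: PiE_def extensional_def)
  ultimately show ?thesis
    by (simp add: e colored_perm_group_one)
qed

lemma incr_above_all:
  assumes "p > 0"
  shows "incr_above n p n = carrier (colored_perm_group n p)"
proof -
  have "\<not> n < \<sigma> i" if "(s, \<sigma>) \<in> carrier (colored_perm_group n p)" "i \<in> {1..n}" for s \<sigma> i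
    using that permutes_in_image[of \<sigma> "{1..n}" i] colored_perm_group_carrier[OF assms] by auto
  then show ?thesis
    unfolding incr_above_def by blast
qed

text \<open>Multiplication by the inverse undoes a step: the letter at place \<open>m\<close>
  returns to the front and loses color \<open>j\<close>, the others keep their order. A value up to
  \<open>a\<close> is unconstrained, so any \<open>j\<close> works. The value \<open>a + 1\<close>
  is the smallest constrained one, so it may stand first once \<open>j = s m\<close> has made it
  uncolored.\<close>

lemma incr_above_remove:
  assumes p: "p > 0" and m: "m \<in> {1..n}" and j: "j \<in> {0..<int p}"
    and x: "(s, \<sigma>) \<in> carrier (colored_perm_group n p)"
    and cases: "(s, \<sigma>) \<in> incr_above n p a \<and> \<sigma> m \<le> a \<or>
      (s, \<sigma>) \<in> incr_above n p (Suc a) \<and> \<sigma> m = Suc a \<and> j = s m"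
  shows "(s, \<sigma>) \<otimes>\<^bsub>colored_perm_group n p\<^esub> inv\<^bsub>colored_perm_group n p\<^esub> (insertion n j m)
    \<in> incr_above n p a"
proof -
  let ?G = "colored_perm_group n p"
  interpret group ?G by (rule group_colored_perm_group)
  let ?b = "insertion n j m" and ?\<beta> = "insertion_perm m"
  have b: "?b \<in> carrier ?G"
    by (rule insertion_in_carrier) fact+
  obtain t \<tau> where u: "(s, \<sigma>) \<otimes>\<^bsub>?G\<^esub> inv\<^bsub>?G\<^esub> ?b = (t, \<tau>)"
    by (metis surj_pair)
  have uG: "(t, \<tau>) \<in> carrier ?G"
    using x b by (simp flip: u)
  have "(t, \<tau>) \<otimes>\<^bsub>?G\<^esub> ?b = (s, \<sigma>)"
    using x b by (simp add: m_assoc flip: u)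
  \<comment> \<open>The word \<open>(t, \<tau>)\<close> precedes the step: its letter at place
    \<open>?\<beta> i\<close> is that of \<open>(s, \<sigma>)\<close> at place \<open>i\<close>, up
    to the color change at \<open>i = m\<close>.\<close>
  then have \<tau>: "\<tau> (?\<beta> i) = \<sigma> i"
    and s: "i \<in> {1..n} \<Longrightarrow> s i = (t (?\<beta> i) + (if i = m then j else 0)) mod int p" for i
    by (auto simp: insertion_def colored_perm_group_mult)
  have \<beta>: "?\<beta> permutes {1..n}"
    by (rule insertion_perm_permutes) fact
  have \<sigma>: "\<sigma> permutes {1..n}"
    using x colored_perm_group_carrier[OF p] by auto
  have t_range: "t (?\<beta> i) \<in> {0..<int p}" if "i \<in> {1..n}" for i
    using uG colored_perm_group_carrier[OF p] permutes_in_image[OF \<beta>, of i] that by auto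
  have color: "t (?\<beta> i) = 0" if i: "i \<in> {1..n}" and "a < \<sigma> i" for i
  proof (cases "i = m")
    case False
    then have "s i = t (?\<beta> i)"
      using s[OF i] t_range[OF i] by simp
    \<comment> \<open>In the second case only place \<open>m\<close> holds \<open>a + 1\<close>, so
      other values above \<open>a\<close> exceed \<open>a + 1\<close> and fall under the assumption
      for \<open>Suc a\<close>.\<close>
    moreover have "Suc a < \<sigma> i" if "\<sigma> m = Suc a"
      using False that \<open>a < \<sigma> i\<close> permutes_inj[OF \<sigma>] by (metis Suc_lessI injD)
    ultimately show ?thesis
      using cases that by (auto simp: incr_above_def)
  next
    case True
    \<comment> \<open>A value above \<open>a\<close> at place \<open>m\<close> excludes the first
      case, leaving \<open>j = s m\<close>; cancelling \<open>j\<close> modulo \<open>p\<close> then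
      gives color 0.\<close>
    then have "s m = j"
      using cases \<open>a < \<sigma> i\<close> by auto
    then have "j = (t (?\<beta> i) + j) mod int p"
      using s[OF i] True by simp
    then have "(t (?\<beta> i) + j) mod int p = (0 + j) mod int p"
      using j by simp
    then have "t (?\<beta> i) mod int p = 0 mod int p"
      by (metis add_diff_cancel_right' mod_diff_left_eq)
    then show ?thesis
      using t_range[OF i] by simp
  qed
  have order: "\<sigma> i < \<sigma> i'"
    if i: "i \<in> {1..n}" "i' \<in> {1..n}" and lt: "?\<beta> i < ?\<beta> i'" and a: "a < \<sigma> i" "a < \<sigma> i'" for i i'
  proof (cases "i = m")
    case True
    then have "\<sigma> i = Suc a"
      using cases a by auto
    moreover have "\<sigma> i' \<noteq> \<sigma> i"
      using lt permutes_inj[OF \<sigma>] by (metis injD less_irrefl)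
    ultimately show ?thesis
      using a by simp
  next
    case False
    \<comment> \<open>Otherwise \<open>?\<beta> i'\<close> would be 1, and no place precedes the
      first.\<close>
    have "i' \<noteq> m"
      using lt i permutes_in_image[OF \<beta>, of i] by (auto simp: insertion_perm_def)
    then have "i < i'"
      using lt False i by (auto simp: insertion_perm_def split: if_splits)
    moreover have "Suc a < \<sigma> i" "Suc a < \<sigma> i'" if "\<sigma> m = Suc a"
      using False \<open>i' \<noteq> m\<close> that a permutes_inj[OF \<sigma>] by (metis Suc_lessI injD)+
    ultimately show ?thesis
      using cases i a by (auto simp: incr_above_def)
  qed
  have surj: "\<exists>i\<in>{1..n}. i' = ?\<beta> i" if "i' \<in> {1..n}" for i'
    using permutes_image[OF \<beta>] that by auto
  have "t i = 0 \<and> (\<forall>i'\<in>{1..n}. i < i' \<longrightarrow> a < \<tau> i' \<longrightarrow> \<tau> i < \<tau> i')"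
    if "i \<in> {1..n}" "a < \<tau> i" for i
    using surj[OF that(1)] that(2) color order surj \<tau> by metis
  then show ?thesis
    using uG by (auto simp: u incr_above_def)
qed

text \<open>The main term counts pairs whose place \<open>m\<close> holds one of the values
  \<open>1, ..., a\<close>, with any color \<open>j\<close>; the extra 1 is the letter
  \<open>a + 1\<close> with its own color. The guard \<open>a < n\<close> ensures that this letter
  exists.\<close>

lemma count_removals:
  assumes p: "p > 0" and a: "a \<le> n" and x: "x \<in> carrier (colored_perm_group n p)"
  shows "real p * real a * of_bool (x \<in> incr_above n p a)
      + of_bool (a < n \<and> x \<in> incr_above n p (Suc a))
    \<le> (\<Sum>(j, m)\<in>{0..<int p} \<times> {1..n}. of_bool
      (x \<otimes>\<^bsub>colored_perm_group n p\<^esub> inv\<^bsub>colored_perm_group n p\<^esub> (insertion n j m)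
        \<in> incr_above n p a))"
proof -
  let ?G = "colored_perm_group n p" and ?J = "{0..<int p}" and ?I = "{1..n}"
  obtain s \<sigma> where e: "x = (s, \<sigma>)" by (cases x)
  have s: "s \<in> ?I \<rightarrow>\<^sub>E ?J" and \<sigma>: "\<sigma> permutes ?I"
    using x colored_perm_group_carrier[OF p] by (auto simp: e)
  define M where "M = {m \<in> ?I. \<sigma> m \<le> a}"
  define D where "D = (if x \<in> incr_above n p a then ?J \<times> M else {})"
  define E where "E = (if a < n \<and> x \<in> incr_above n p (Suc a)
    then {(s m, m) | m. m \<in> ?I \<and> \<sigma> m = Suc a} else {})"
  define R where "R = {(j, m) \<in> ?J \<times> ?I. x \<otimes>\<^bsub>?G\<^esub> inv\<^bsub>?G\<^esub> (insertion n j m) \<in> incr_above n p a}"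
  have finR: "finite R"
    by (rule finite_subset[of _ "?J \<times> ?I"]) (auto simp: R_def)
  have "D \<subseteq> R"
    using incr_above_remove[OF p _ _ x[unfolded e]]
    by (auto simp: D_def R_def M_def e)
  moreover have "E \<subseteq> R"
  proof
    fix y assume "y \<in> E"
    then obtain m where y: "y = (s m, m)" and m: "m \<in> ?I" "\<sigma> m = Suc a"
      and "x \<in> incr_above n p (Suc a)"
      by (auto simp: E_def split: if_splits)
    moreover have "s m \<in> ?J"
      using s m by auto
    ultimately show "y \<in> R"
      using incr_above_remove[OF p _ _ x[unfolded e], of m "s m" a] by (simp add: R_def e)
  qed
  ultimately have sub: "D \<union> E \<subseteq> R"
    by simp
  have "\<sigma> ` M = {1..a}"
  proof (intro equalityI subsetI)
    fix v assume "v \<in> \<sigma> ` M"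
    then show "v \<in> {1..a}"
      using permutes_in_image[OF \<sigma>] by (auto simp: M_def)
  next
    fix v assume v: "v \<in> {1..a}"
    then have "v \<in> \<sigma> ` ?I"
      using a permutes_image[OF \<sigma>] by auto
    then show "v \<in> \<sigma> ` M"
      using v by (auto simp: M_def)
  qed
  then have "card M = a"
    using card_image[OF permutes_inj_on[OF \<sigma>], of M] by simp
  then have cardD: "card D = p * a * of_bool (x \<in> incr_above n p a)"
    by (simp add: D_def card_cartesian_product)
  have "card E \<ge> of_bool (a < n \<and> x \<in> incr_above n p (Suc a))"
  proof (cases "a < n \<and> x \<in> incr_above n p (Suc a)")
    case True
    then have "Suc a \<in> \<sigma> ` ?I"
      using permutes_image[OF \<sigma>] by auto
    then have "E \<noteq> {}"
      using True by (auto simp: E_def)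
    moreover have "finite E"
      using finite_subset[OF sub finR] by simp
    ultimately show ?thesis
      by (simp add: Suc_le_eq card_gt_0_iff)
  qed auto
  \<comment> \<open>The value at place \<open>m\<close> is at most \<open>a\<close> in
    \<open>D\<close> and equals \<open>a + 1\<close> in \<open>E\<close>.\<close>
  moreover have "card (D \<union> E) = card D + card E"
    using finite_subset[OF sub finR]
    by (intro card_Un_disjoint) (auto simp: D_def E_def M_def split: if_splits)
  ultimately have "p * a * of_bool (x \<in> incr_above n p a)
      + of_bool (a < n \<and> x \<in> incr_above n p (Suc a)) \<le> card R"
    using card_mono[OF finR sub] cardD by linarith
  then have "real (p * a * of_bool (x \<in> incr_above n p a)
      + of_bool (a < n \<and> x \<in> incr_above n p (Suc a))) \<le> real (card R)"
    by (rule of_nat_mono)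
  also have "real (card R) = (\<Sum>y\<in>?J \<times> ?I. of_bool (y \<in> R))"
  proof -
    have "?J \<times> ?I \<inter> {y. y \<in> R} = R"
      by (auto simp: R_def)
    then show ?thesis
      by simp
  qed
  also have "\<dots> = (\<Sum>(j, m)\<in>?J \<times> ?I. of_bool
      (x \<otimes>\<^bsub>?G\<^esub> inv\<^bsub>?G\<^esub> (insertion n j m) \<in> incr_above n p a))"
    by (rule sum.cong) (auto simp: R_def)
  finally show ?thesis
    by simp
qed

section \<open>Powers of the top-to-random element\<close>

text \<open>The weight is \<open>p^(k-a) S(k,a)\<close>, written as a real quotient so that no
  truncated subtraction enters for \<open>a > k\<close>.\<close>

definition stirling_minorant ::
  "nat \<Rightarrow> nat \<Rightarrow> nat \<Rightarrow> (nat \<Rightarrow> int) \<times> (nat \<Rightarrow> nat) \<Rightarrow> real" where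
  "stirling_minorant n p k x =
    (\<Sum>a\<le>n. real p ^ k / real p ^ a * real (Stirling k a) * of_bool (x \<in> incr_above n p a))"

lemma stirling_minorant_nonneg: "stirling_minorant n p k x \<ge> 0"
  by (auto simp: stirling_minorant_def intro!: sum_nonneg)

lemma stirling_minorant_0:
  assumes "p > 0"
  shows "stirling_minorant n p 0 x \<le> of_bool (x = \<one>\<^bsub>colored_perm_group n p\<^esub>)"
proof -
  have "stirling_minorant n p 0 x = (\<Sum>a\<le>n. if a = 0 then of_bool (x \<in> incr_above n p 0) else 0)"
    unfolding stirling_minorant_def by (rule sum.cong) auto
  also have "\<dots> = of_bool (x \<in> incr_above n p 0)"
    by simp
  finally show ?thesis
    using incr_above_0[OF assms] by auto
qed

text \<open>By the Stirling recursion, the new weight at \<open>a + 1\<close> is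
  \<open>p (a + 1)\<close> times the old weight at \<open>a + 1\<close>, plus the old weight at
  \<open>a\<close>. These factors are the two counts in \<open>count_removals\<close>.\<close>

lemma stirling_minorant_Suc:
  assumes p: "p > 0" and x: "x \<in> carrier (colored_perm_group n p)"
  shows "stirling_minorant n p (Suc k) x \<le> (\<Sum>(j, m)\<in>{0..<int p} \<times> {1..n}. stirling_minorant n p k
    (x \<otimes>\<^bsub>colored_perm_group n p\<^esub> inv\<^bsub>colored_perm_group n p\<^esub> (insertion n j m)))"
proof -
  let ?G = "colored_perm_group n p" and ?J = "{0..<int p}" and ?I = "{1..n}"
  let ?u = "\<lambda>j m. x \<otimes>\<^bsub>?G\<^esub> inv\<^bsub>?G\<^esub> (insertion n j m)"
  define A :: "nat \<Rightarrow> real" where "A a = of_bool (x \<in> incr_above n p a)" for a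
  define q where "q a = real p ^ k / real p ^ a * real (Stirling k a)" for a
  have step: "real p ^ Suc k / real p ^ Suc a * real (Stirling (Suc k) (Suc a)) =
      q (Suc a) * (real p * real (Suc a)) + q a" for a
    using p by (simp add: q_def field_simps)
  \<comment> \<open>The term \<open>a = 0\<close> drops out because
    \<open>S(k+1,0) = 0\<close>.\<close>
  have "stirling_minorant n p (Suc k) x =
      (\<Sum>a<n. real p ^ Suc k / real p ^ Suc a * real (Stirling (Suc k) (Suc a)) * A (Suc a))"
    unfolding stirling_minorant_def A_def by (subst sum.atMost_shift) simp
  also have "\<dots> = (\<Sum>a<n. q (Suc a) * (real p * real (Suc a)) * A (Suc a)) + (\<Sum>a<n. q a * A (Suc a))"
    unfolding step by (simp add: sum.distrib distrib_right)
  \<comment> \<open>The added term \<open>a = 0\<close> vanishes through its factor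
    \<open>a\<close>.\<close>
  also have "(\<Sum>a<n. q (Suc a) * (real p * real (Suc a)) * A (Suc a)) =
      (\<Sum>a\<le>n. q a * (real p * real a) * A a)"
    by (subst sum.atMost_shift) simp
  \<comment> \<open>The added term \<open>a = n\<close> vanishes because the guard
    \<open>a < n\<close> fails.\<close>
  also have "(\<Sum>a<n. q a * A (Suc a)) = (\<Sum>a\<le>n. q a * of_bool (a < n \<and> x \<in> incr_above n p (Suc a)))"
    by (rule sum.mono_neutral_cong_left) (auto simp: A_def)
  also have "(\<Sum>a\<le>n. q a * (real p * real a) * A a) + \<dots> =
      (\<Sum>a\<le>n. q a * (real p * real a * of_bool (x \<in> incr_above n p a)
        + of_bool (a < n \<and> x \<in> incr_above n p (Suc a))))"
    by (simp only: A_def distrib_left sum.distrib mult.assoc)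
  also have "\<dots> \<le> (\<Sum>a\<le>n. q a * (\<Sum>(j, m)\<in>?J \<times> ?I. of_bool (?u j m \<in> incr_above n p a)))"
    using count_removals[OF p _ x] by (intro sum_mono mult_left_mono) (auto simp: q_def)
  also have "\<dots> = (\<Sum>(j, m)\<in>?J \<times> ?I. stirling_minorant n p k (?u j m))"
    unfolding stirling_minorant_def q_def case_prod_unfold sum_distrib_left
    by (rule sum.swap)
  finally show ?thesis .
qed

text \<open>In the convolution sum for the next power, only the factors \<open>b\<close> that are
  insertions are kept, each of weight at least \<open>1/(pn)\<close>; the discarded terms are
  nonnegative. The induction leaves \<open>x\<close> arbitrary because its hypothesis is applied to
  \<open>x\<close> times \<open>inv b\<close>.\<close>

lemma pow_B\<^sub>1_minorant:
  fixes n p k :: nat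
  assumes n: "n \<ge> 1" and p: "p > 0" and x: "x \<in> carrier (colored_perm_group n p)"
  defines "P \<equiv> (1 / (real p * real n)) \<odot>\<^bsub>group_algebra (colored_perm_group n p)\<^esub> B\<^sub>1 n p"
  shows "stirling_minorant n p k x / (real p * real n) ^ k \<le>
    (P [^]\<^bsub>group_algebra (colored_perm_group n p)\<^esub> k) x"
  using x
proof (induction k arbitrary: x)
  case 0
  then show ?case
    using stirling_minorant_0[OF p, of n x] by (auto simp: group_algebra_simps)
next
  case (Suc k)
  let ?G = "colored_perm_group n p" and ?JI = "{0..<int p} \<times> {1..n}"
  let ?r = "real p * real n" and ?ins = "\<lambda>(j, m). insertion n j m"
  interpret group ?G by (rule group_colored_perm_group)
  define Q where "Q = P [^]\<^bsub>group_algebra ?G\<^esub> k"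
  have fin: "finite (carrier ?G)"
    by (rule finite_colored_perm_group[OF p])
  note P = top_to_random_distribution[OF n p, folded P_def]
  note Q = group_algebra_pow_distribution[OF fin P, where k = k, folded Q_def]
  have sub: "?ins ` ?JI \<subseteq> carrier ?G"
    using insertion_in_carrier by auto
  have "stirling_minorant n p (Suc k) x / ?r ^ Suc k \<le>
      (\<Sum>y\<in>?JI. stirling_minorant n p k (x \<otimes>\<^bsub>?G\<^esub> inv\<^bsub>?G\<^esub> ?ins y)) / ?r ^ Suc k"
    using stirling_minorant_Suc[OF p Suc.prems, of k]
    by (intro divide_right_mono) (auto simp: case_prod_unfold)
  also have "\<dots> = (\<Sum>y\<in>?JI. stirling_minorant n p k (x \<otimes>\<^bsub>?G\<^esub> inv\<^bsub>?G\<^esub> ?ins y) / ?r ^ k * (1 / ?r))"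
    by (simp add: sum_divide_distrib mult.commute)
  also have "\<dots> \<le> (\<Sum>y\<in>?JI. Q (x \<otimes>\<^bsub>?G\<^esub> inv\<^bsub>?G\<^esub> ?ins y) * P (?ins y))"
  proof (intro sum_mono mult_mono)
    fix y assume y: "y \<in> ?JI"
    then have "?ins y \<in> carrier ?G"
      using sub by blast
    then show "stirling_minorant n p k (x \<otimes>\<^bsub>?G\<^esub> inv\<^bsub>?G\<^esub> ?ins y) / ?r ^ k
        \<le> Q (x \<otimes>\<^bsub>?G\<^esub> inv\<^bsub>?G\<^esub> ?ins y)"
      unfolding Q_def using Suc.prems by (intro Suc.IH) simp
    show "1 / ?r \<le> P (?ins y)"
      using B\<^sub>1_insertion y
      by (auto simp: P_def group_algebra_simps intro!: divide_right_mono)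
  qed (use Q(2) in \<open>auto simp: stirling_minorant_nonneg\<close>)
  also have "\<dots> = (\<Sum>b\<in>?ins ` ?JI. Q (x \<otimes>\<^bsub>?G\<^esub> inv\<^bsub>?G\<^esub> b) * P b)"
    by (simp only: sum.reindex[OF inj_on_insertion] o_def)
  also have "\<dots> \<le> (\<Sum>b\<in>carrier ?G. Q (x \<otimes>\<^bsub>?G\<^esub> inv\<^bsub>?G\<^esub> b) * P b)"
    using sub Q(2) P(2) by (intro sum_mono2 fin) auto
  also have "\<dots> = (P [^]\<^bsub>group_algebra ?G\<^esub> Suc k) x"
    using Suc.prems by (simp add: group_algebra_mult[OF fin Q(1) P(1)] flip: Q_def)
  finally show ?case .
qed

theorem theorem6:
  fixes n p k :: nat
  assumes "n \<ge> 1" and "p > 1"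
  shows "d_TV (((1 / (real p * real n)) \<odot>\<^bsub>group_algebra (colored_perm_group n p)\<^esub> B\<^sub>1 n p)
             [^]\<^bsub>group_algebra (colored_perm_group n p)\<^esub> k)
           (uniform_distr n p)
           \<le> 1 - real (Stirling k n) * fact n / real n ^ k"
proof -
  let ?G = "colored_perm_group n p"
  interpret group ?G by (rule group_colored_perm_group)
  have p: "p > 0"
    using assms by simp
  have fin: "finite (carrier ?G)"
    by (rule finite_colored_perm_group[OF p])
  define P where "P = (1 / (real p * real n)) \<odot>\<^bsub>group_algebra ?G\<^esub> B\<^sub>1 n p"
  note pow = group_algebra_pow_distribution
      [OF fin top_to_random_distribution[OF assms(1) p, folded P_def], where k = k]
  have minor: "real (Stirling k n) * fact n / real n ^ k * uniform_distr n p x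
      \<le> (P [^]\<^bsub>group_algebra ?G\<^esub> k) x" if x: "x \<in> carrier ?G" for x
  proof -
    \<comment> \<open>The factor \<open>n!\<close> cancels against the uniform weight
      \<open>1/(p^n n!)\<close>, and expanding by \<open>p^k\<close> leaves the weight at
      \<open>a = n\<close> over \<open>(pn)^k\<close>. This summand is present at every group
      element, since \<open>A\<^sub>n\<close> is the whole group.\<close>
    have "real (Stirling k n) * fact n / real n ^ k * uniform_distr n p x =
        real p ^ k / real p ^ n * real (Stirling k n) / (real p * real n) ^ k"
      using x p by (simp add: uniform_distr_def power_mult_distrib)
    also have "\<dots> \<le> stirling_minorant n p k x / (real p * real n) ^ k"
    proof (rule divide_right_mono)
      have "real p ^ k / real p ^ n * real (Stirling k n) * of_bool (x \<in> incr_above n p n)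
          \<le> stirling_minorant n p k x"
        unfolding stirling_minorant_def by (rule member_le_sum) auto
      then show "real p ^ k / real p ^ n * real (Stirling k n) \<le> stirling_minorant n p k x"
        using x by (simp add: incr_above_all[OF p])
    qed simp
    also have "\<dots> \<le> (P [^]\<^bsub>group_algebra ?G\<^esub> k) x"
      unfolding P_def by (rule pow_B\<^sub>1_minorant[OF assms(1) p x])
    finally show ?thesis .
  qed
  have total: "sum (uniform_distr n p) (carrier ?G) = 1"
    using p by (simp add: uniform_distr_def card_colored_perm_group)
  show ?thesis
    unfolding P_def[symmetric]
    by (rule d_TV_le_of_minorized[OF fin pow(1) pow(3) _ _ total minor])
      (auto simp: uniform_distr_def)
qed

end
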